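(* Let $G$ be a regular Steinhaus graph of odd degree $n$ on $2n\geq4$ vertices $V_1,\ldots,V_{2n}$. Then $G\setminus\{V_1,V_{2n}\}$ is a regular Steinhaus graph of even degree $n-1$ whose associated Steinhaus matrix is multi-symmetric.
   Context: A Steinhaus matrix of size $m\geq1$ is a matrix $M=(a_{i,j})_{1\leq i,j\leq m}$ with entries in $\mathbb{F}_2=\{0,1\}$ such that $a_{i,i}=0$ for all $i$, $a_{i,j}=a_{i-1,j-1}+a_{i-1,j}$ (addition in $\mathbb{F}_2$) for all $2\leq i<j\leq m$, and $a_{i,j}=a_{j,i}$ for all $i,j$. A Steinhaus graph is a simple graph on labelled vertices $V_1,\ldots,V_m$ whose adjacency matrix is a Steinhaus matrix. $G\setminus\{V_1,V_{2n}\}$ denotes the graph obtained by deleting $V_1$ and $V_{2n}$ and their incident edges (its adjacency matrix is $(a_{i,j})_{2\leq i,j\leq 2n-1}$, with vertices relabelled in order). A square matrix $(a_{i,j})$ of size $m$ is doubly-symmetric if $a_{i,j}=a_{j,i}=a_{m-j+1,m-i+1}$ for all $i,j$; it is multi-symmetric if it is doubly-symmetric and $a_{i,j}=a_{i,m-j+i+1}$ for all $1\leq i<j\leq m$. *)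

theory Defs
  imports
    "HOL-Library.Z2"
    "Jordan_Normal_Form.Matrix"
    "Graph_Theory.Digraph"
begin

text \<open>
  \<^typ>\<open>bit\<close> is the field with two elements. Matrices of \<^theory>\<open>Jordan_Normal_Form.Matrix\<close>
  are indexed from 0; \<open>entry\<close> gives access with indices starting at 1, so that \<open>entry M i j\<close>
  is \<open>a\<^sub>i\<^sub>,\<^sub>j\<close> for \<open>1 \<le> i, j \<le> m\<close>.
\<close>

definition entry :: "'a mat \<Rightarrow> nat \<Rightarrow> nat \<Rightarrow> 'a" where
  "entry M i j = M $$ (i - 1, j - 1)"

definition steinhaus_matrix :: "bit mat \<Rightarrow> bool" where
  "steinhaus_matrix M \<longleftrightarrow>
     square_mat M \<and> dim_row M \<ge> 1 \<and>
     (\<forall>i\<in>{1..dim_row M}. entry M i i = 0) \<and>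
     (\<forall>i j. 2 \<le> i \<and> i < j \<and> j \<le> dim_row M \<longrightarrow>
        entry M i j = entry M (i - 1) (j - 1) + entry M (i - 1) j) \<and>
     (\<forall>i\<in>{1..dim_row M}. \<forall>j\<in>{1..dim_row M}. entry M i j = entry M j i)"

definition doubly_symmetric :: "'a mat \<Rightarrow> bool" where
  "doubly_symmetric M \<longleftrightarrow>
     square_mat M \<and>
     (\<forall>i\<in>{1..dim_row M}. \<forall>j\<in>{1..dim_row M}.
        entry M i j = entry M j i \<and>
        entry M j i = entry M (dim_row M - j + 1) (dim_row M - i + 1))"

definition multi_symmetric :: "'a mat \<Rightarrow> bool" where
  "multi_symmetric M \<longleftrightarrow>
     doubly_symmetric M \<and>
     (\<forall>i j. 1 \<le> i \<and> i < j \<and> j \<le> dim_row M \<longrightarrow>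
        entry M i j = entry M i (dim_row M - j + i + 1))"

text \<open>
  A finite simple graph is a \<^locale>\<open>graph\<close>, i.e. a finite symmetric digraph without loops and
  multiple arcs; an edge is a pair of opposite arcs, so the degree of a vertex is its
  \<^const>\<open>out_degree\<close>. A labelling is a function \<open>V\<close> whose values at \<open>1, \<dots>, m\<close> enumerate the
  vertices; its other values are irrelevant.
\<close>

definition labelled_graph :: "('a, 'b) pre_digraph \<Rightarrow> (nat \<Rightarrow> 'a) \<Rightarrow> nat \<Rightarrow> bool" where
  "labelled_graph G V m \<longleftrightarrow> graph G \<and> bij_betw V {1..m} (verts G)"

definition adjacency_matrix :: "('a, 'b) pre_digraph \<Rightarrow> (nat \<Rightarrow> 'a) \<Rightarrow> nat \<Rightarrow> bit mat" where
  "adjacency_matrix G V m =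
     mat m m (\<lambda>(i, j). if V (i + 1) \<rightarrow>\<^bsub>G\<^esub> V (j + 1) then 1 else 0)"

definition steinhaus_graph :: "('a, 'b) pre_digraph \<Rightarrow> (nat \<Rightarrow> 'a) \<Rightarrow> nat \<Rightarrow> bool" where
  "steinhaus_graph G V m \<longleftrightarrow>
     labelled_graph G V m \<and> steinhaus_matrix (adjacency_matrix G V m)"

definition regular_of_degree :: "('a, 'b) pre_digraph \<Rightarrow> nat \<Rightarrow> bool" where
  "regular_of_degree G d \<longleftrightarrow> (\<forall>v\<in>verts G. out_degree G v = d)"

lemma entry_adjacency_matrix:
  assumes "i \<in> {1..m}" "j \<in> {1..m}"
  shows "entry (adjacency_matrix G V m) i j = (if V i \<rightarrow>\<^bsub>G\<^esub> V j then 1 else 0)"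
  using assms by (auto simp: entry_def adjacency_matrix_def)

end

theory Submission
  imports Defs
begin

text \<open>
  Let \<open>m = 2 n\<close>. Modulo 2 the rows and columns of a Steinhaus matrix telescope, so that evenness of all degrees
  is a linear relation between the three sides of an enlarged triangle, and the dihedral symmetry
  of the Steinhaus rule turns this relation into double symmetry (Dymacek). Odd degrees reduce to
  this case by adding a star at \<open>V\<^sub>1\<close>, which alters only the first row: the inner matrix is
  doubly-symmetric and \<open>a\<^sub>m\<^sub>+\<^sub>1\<^sub>-\<^sub>j\<^sub>,\<^sub>m = a\<^sub>1\<^sub>,\<^sub>j + 1\<close>. Now \<open>V\<^sub>i\<close> and \<open>V\<^sub>m\<^sub>+\<^sub>1\<^sub>-\<^sub>i\<close> have equal degrees both
  in \<open>G\<close> and in the inner graph; comparing them gives \<open>a\<^sub>1\<^sub>,\<^sub>i = a\<^sub>1\<^sub>,\<^sub>m\<^sub>+\<^sub>1\<^sub>-\<^sub>i\<close>, so exactly one of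
  \<open>V\<^sub>1\<close>, \<open>V\<^sub>m\<close> is adjacent to \<open>V\<^sub>i\<close>. The symmetry of the first row descends to all the others.
\<close>

section \<open>Characteristic 2, and Steinhaus triangles under the dihedral group\<close>

declare add_bit_eq_xor [simp del]

lemma bit_add_self [simp]: "a + a = (0::bit)"
  by (cases a) simp_all

lemma bit_add_self_left [simp]: "a + (a + b) = (b::bit)"
  by (cases a) simp_all

lemma bit_eq_iff_add: "a = b \<longleftrightarrow> a + b = (0::bit)"
  by (cases a; cases b) simp_all

text \<open>Barycentric coordinates on the points with \<open>p + q + r = N\<close>. Over F_2 the
  recursion says that the corners of each small triangle sum to 0; this favours no corner, so every
  permutation of the coordinates preserves it.\<close>

definition steinhaus_triangle :: "nat \<Rightarrow> (nat \<Rightarrow> nat \<Rightarrow> nat \<Rightarrow> bit) \<Rightarrow> bool" where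
  "steinhaus_triangle N f \<longleftrightarrow>
     (\<forall>p q r. Suc (p + q + r) = N \<longrightarrow> f (Suc p) q r + f p (Suc q) r + f p q (Suc r) = 0)"

lemma steinhaus_triangleD:
  "steinhaus_triangle N f \<Longrightarrow> Suc (p + q + r) = N \<Longrightarrow>
    f (Suc p) q r + f p (Suc q) r + f p q (Suc r) = 0"
  by (simp add: steinhaus_triangle_def)

lemma steinhaus_triangle_swap:
  "steinhaus_triangle N f \<Longrightarrow> steinhaus_triangle N (\<lambda>p q r. f q p r)"
  "steinhaus_triangle N f \<Longrightarrow> steinhaus_triangle N (\<lambda>p q r. f r q p)"
  by (simp_all add: steinhaus_triangle_def ac_simps)

lemma steinhaus_triangle_add:
  assumes "steinhaus_triangle N f" "steinhaus_triangle N g"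
  shows "steinhaus_triangle N (\<lambda>p q r. f p q r + g p q r)"
  unfolding steinhaus_triangle_def
proof (intro allI impI)
  fix p q r assume "Suc (p + q + r) = N"
  with assms have "(f (Suc p) q r + f p (Suc q) r + f p q (Suc r)) +
      (g (Suc p) q r + g p (Suc q) r + g p q (Suc r)) = 0"
    by (simp only: steinhaus_triangleD add_0_right)
  then show "f (Suc p) q r + g (Suc p) q r + (f p (Suc q) r + g p (Suc q) r) +
      (f p q (Suc r) + g p q (Suc r)) = 0"
    by (simp only: ac_simps)
qed

text \<open>The rule computes an entry at height \<open>Suc p\<close> from two at height
  \<open>p\<close>, so the top side determines the triangle. Applied to sums, this spreads an
  identity along that side to all entries.\<close>

lemma steinhaus_triangle_eq_0:
  assumes f: "steinhaus_triangle N f" and side: "\<And>q r. q + r = N \<Longrightarrow> f 0 q r = 0"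
  shows "p + q + r = N \<Longrightarrow> f p q r = 0"
proof (induction p arbitrary: q r)
  case 0
  then show ?case by (simp add: side)
next
  case (Suc p)
  then have "f p (Suc q) r = 0" "f p q (Suc r) = 0" by auto
  moreover have "f (Suc p) q r + f p (Suc q) r + f p q (Suc r) = 0"
    using f Suc.prems by (intro steinhaus_triangleD) auto
  ultimately show ?case by simp
qed

text \<open>
  Let \<open>x\<close>, \<open>y\<close>, \<open>z\<close> be the top, right and left sides of the triangle. The hypothesis \<open>x = z + y\<close>
  says that the sum of three images of the triangle under the dihedral group has zero top side,
  so this sum vanishes. Its left side reads \<open>z + x + rev x = 0\<close>, whence \<open>y = rev x\<close>.
\<close>
lemma steinhaus_triangle_reflection:
  assumes f: "steinhaus_triangle N f"
    and sides: "\<And>q r. q + r = N \<Longrightarrow> f 0 q r = f q 0 r + f q r 0"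
    and N: "p + q + r = N"
  shows "f p q r = f r q p"
proof -
  note swap = steinhaus_triangle_swap[OF f]
  have S: "steinhaus_triangle N (\<lambda>p q r. f p q r + f q p r + f q r p)"
    by (rule steinhaus_triangle_add[OF steinhaus_triangle_add[OF f swap(1)]
          steinhaus_triangle_swap(2)[OF swap(1)]])
  have top: "f 0 q r + f q 0 r + f q r 0 = 0" if "q + r = N" for q r
    using sides[OF that] by (simp only: bit_eq_iff_add[of "f 0 q r"] add.assoc)
  have sum0: "f p q r + f q p r + f q r p = 0" if "p + q + r = N" for p q r
    by (rule steinhaus_triangle_eq_0[OF S top that])
  have side: "f 0 q r = f r q 0" if "q + r = N" for q r
    using sum0[of r 0 q] sides[of r q] that
    by (cases "f 0 q r"; cases "f r q 0"; cases "f r 0 q"; cases "f 0 r q") (auto simp: ac_simps)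
  have "steinhaus_triangle N (\<lambda>p q r. f p q r + f r q p)"
    by (rule steinhaus_triangle_add[OF f swap(2)])
  then have "f p q r + f r q p = 0"
    by (rule steinhaus_triangle_eq_0[where f = "\<lambda>p q r. f p q r + f r q p"])
      (use N side in auto)
  then show ?thesis by (subst bit_eq_iff_add)
qed

section \<open>The Steinhaus recursion: degree parities and symmetry of the entries\<close>

locale steinhaus =
  fixes m :: nat and a :: "nat \<Rightarrow> nat \<Rightarrow> bit"
  assumes rule: "2 \<le> i \<Longrightarrow> i < j \<Longrightarrow> j \<le> m \<Longrightarrow> a i j = a (i - 1) (j - 1) + a (i - 1) j"
begin

text \<open>By the rule, row \<open>i + 1\<close> consists of the differences of row
  \<open>i\<close>, so the sum telescopes.\<close>

lemma sum_row:
  assumes "1 \<le> i" "Suc i \<le> k" "k \<le> m"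
  shows "(\<Sum>j\<in>{Suc i<..k}. a (Suc i) j) = a i (Suc i) + a i k"
  using assms(2,3)
proof (induction k rule: dec_induct)
  case (step k)
  have "{Suc i<..Suc k} = insert (Suc k) {Suc i<..k}" using step by auto
  then show ?case using step assms(1) rule[of "Suc i" "Suc k"] by (simp add: ac_simps)
qed simp

text \<open>Read as \<open>a i j = a i (j + 1) + a (i + 1) (j + 1)\<close>, the rule makes column
  \<open>j\<close> the differences of column \<open>j + 1\<close>, which exists since
  \<open>j < m\<close>.\<close>

lemma sum_column:
  assumes "1 \<le> k" "k \<le> j" "j < m"
  shows "(\<Sum>i\<in>{1..<k}. a i j) = a 1 (Suc j) + a k (Suc j)"
  using assms(1,2)
proof (induction k rule: dec_induct)
  case (step k)
  then show ?case using assms(3) rule[of "Suc k" "Suc j"] by (simp add: ac_simps)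
qed simp

text \<open>After telescoping, evenness at vertex \<open>i + 1\<close> says that successive
  superdiagonal entries differ by one entry of the first row plus one of the last column. Summation
  relates the three sides.\<close>

lemma superdiagonal_eq:
  assumes even_deg: "\<And>i. 1 \<le> i \<Longrightarrow> i < m \<Longrightarrow> (\<Sum>k\<in>{1..<i}. a k i) + (\<Sum>j\<in>{i<..m}. a i j) = 0"
    and "1 \<le> i" "i < m"
  shows "a i (Suc i) = (\<Sum>j\<in>{2..Suc i}. a 1 j) + (\<Sum>k\<in>{1..<i}. a k m)"
  using assms(2,3)
proof (induction i rule: dec_induct)
  case (step i)
  have "(\<Sum>k\<in>{1..<Suc i}. a k (Suc i)) = a 1 (Suc (Suc i)) + a (Suc i) (Suc (Suc i))"
    using step by (intro sum_column) auto
  moreover have "(\<Sum>j\<in>{Suc i<..m}. a (Suc i) j) = a i (Suc i) + a i m"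
    using step by (intro sum_row) auto
  ultimately have "a 1 (Suc (Suc i)) + a (Suc i) (Suc (Suc i)) + (a i (Suc i) + a i m) = 0"
    using even_deg[of "Suc i"] step by (simp only:)
  then have "a (Suc i) (Suc (Suc i)) = a 1 (Suc (Suc i)) + a i (Suc i) + a i m"
    by (subst bit_eq_iff_add) (simp add: ac_simps)
  then show ?case using step by (simp add: ac_simps)
qed (simp add: numeral_2_eq_2)

text \<open>
  The triangle is enlarged by a row \<open>0\<close> and a column \<open>m + 1\<close>, whose corners vanish because
  \<open>V\<^sub>1\<close> has even degree. Entry \<open>(i, j)\<close> has barycentric coordinates \<open>(i, j - i - 1, m + 1 - j)\<close>.
\<close>
lemma even_imp_doubly_symmetric:
  assumes even_deg: "\<And>i. 1 \<le> i \<Longrightarrow> i < m \<Longrightarrow> (\<Sum>k\<in>{1..<i}. a k i) + (\<Sum>j\<in>{i<..m}. a i j) = 0"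
    and ij: "1 \<le> i" "i < j" "j \<le> m"
  shows "a i j = a (m + 1 - j) (m + 1 - i)"
proof -
  \<comment> \<open>Partial sums of the first row and of the last column extend the rule outwards.
    At the corner \<open>q = m\<close> no further entry is available; \<open>min\<close> makes the
    value there the degree of vertex 1 modulo 2.\<close>
  define f where "f p q r =
    (if p = 0 then \<Sum>j\<in>{2..min (Suc q) m}. a 1 j
     else if r = 0 then \<Sum>k\<in>{1..<p}. a k m
     else a p (Suc (p + q)))" for p q r :: nat
  have "{1<..m} = {2..m}" by auto
  then have deg1: "(\<Sum>j\<in>{2..m}. a 1 j) = 0" using even_deg[of 1] ij by simp
  have "steinhaus_triangle m f"
    unfolding steinhaus_triangle_def
  proof (intro allI impI)
    fix p q r assume pqr: "Suc (p + q + r) = m"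
    consider "p = 0" "r = 0" | "p = 0" "r > 0" | "p > 0" "r = 0" | "p > 0" "r > 0" by blast
    then show "f (Suc p) q r + f p (Suc q) r + f p q (Suc r) = 0"
    proof cases
      case 1
      then show ?thesis using pqr by (simp add: f_def)
    next
      case 2
      then have "(\<Sum>j\<in>{2..Suc (Suc q)}. a 1 j) = (\<Sum>j\<in>{2..Suc q}. a 1 j) + a 1 (Suc (Suc q))"
        by simp
      then show ?thesis using 2 pqr by (simp add: f_def min_def ac_simps)
    next
      case 3
      then show ?thesis using pqr by (simp add: f_def ac_simps)
    next
      case 4
      then show ?thesis using pqr rule[of "Suc p" "Suc (Suc (p + q))"]
        by (simp add: f_def ac_simps)
    qed
  qed
  \<comment> \<open>Away from the corners this is \<open>superdiagonal_eq\<close>, as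
    \<open>f q 0 r\<close> is \<open>a q (q + 1)\<close>.\<close>
  moreover have "f 0 q r = f q 0 r + f q r 0" if qr: "q + r = m" for q r
  proof -
    consider "q = 0" | "r = 0" "q > 0" | "q > 0" "r > 0" by blast
    then show ?thesis
    proof cases
      case 1
      then show ?thesis using qr deg1 by (simp add: f_def)
    next
      case 2
      then show ?thesis using qr deg1 by (simp add: f_def)
    next
      case 3
      then show ?thesis using qr superdiagonal_eq[OF even_deg, of q]
        by (simp add: f_def min_def ac_simps)
    qed
  qed
  ultimately have "f i (j - i - 1) (m + 1 - j) = f (m + 1 - j) (j - i - 1) i"
    by (rule steinhaus_triangle_reflection) (use ij in auto)
  moreover have "Suc (m + 1 - j + (j - i - 1)) = m + 1 - i" using ij by simp
  ultimately show ?thesis using ij by (simp add: f_def)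
qed

text \<open>
  Adding the star with centre \<open>V\<^sub>1\<close>, which is a Steinhaus graph, changes the parity of every
  degree when \<open>m\<close> is even.
\<close>
lemma odd_imp_doubly_symmetric:
  assumes "even m"
    and odd_deg: "\<And>i. 1 \<le> i \<Longrightarrow> i < m \<Longrightarrow> (\<Sum>k\<in>{1..<i}. a k i) + (\<Sum>j\<in>{i<..m}. a i j) = 1"
  shows "\<And>i j. 2 \<le> i \<Longrightarrow> i < j \<Longrightarrow> j < m \<Longrightarrow> a i j = a (m + 1 - j) (m + 1 - i)"
    and "\<And>j. 2 \<le> j \<Longrightarrow> j < m \<Longrightarrow> a (m + 1 - j) m = a 1 j + 1"
proof -
  \<comment> \<open>Only row 1 changes, so \<open>b\<close> need not be symmetric; the locale asks
    only for the recursion above the diagonal.\<close>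
  define b where "b i j = a i j + of_bool (i = 1)" for i j :: nat
  interpret b: steinhaus m b
  proof
    fix i j assume "2 \<le> i" "i < j" "j \<le> m"
    then show "b i j = b (i - 1) (j - 1) + b (i - 1) j"
      using rule[of i j] by (simp add: b_def ac_simps)
  qed
  have "(\<Sum>k\<in>{1..<i}. b k i) + (\<Sum>j\<in>{i<..m}. b i j) = 0" if i: "1 \<le> i" "i < m" for i
  proof (cases "i = 1")
    case True
    have "of_nat (m - 1) = (1::bit)"
      using \<open>even m\<close> i by (cases m) (auto elim!: oddE)
    then show ?thesis
      using odd_deg[of 1] i True by (simp add: b_def sum.distrib)
  next
    case False
    then have "(\<Sum>k\<in>{1..<i}. of_bool (k = 1)) = (1::bit)"
      using i by (simp add: of_bool_def sum.delta)
    then show ?thesis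
      using odd_deg[of i] i False by (simp add: b_def sum.distrib ac_simps)
  qed
  note sym = b.even_imp_doubly_symmetric[OF this]
  show "a i j = a (m + 1 - j) (m + 1 - i)" if "2 \<le> i" "i < j" "j < m" for i j
    using sym[of i j] that by (simp add: b_def)
  \<comment> \<open>Of the two positions exchanged by the reflection, only \<open>(1, j)\<close>
    lies in row 1, so the added 1 remains on one side.\<close>
  show "a (m + 1 - j) m = a 1 j + 1" if "2 \<le> j" "j < m" for j
    using sym[of 1 j] that by (simp add: b_def)
qed

text \<open>Row \<open>i + 1\<close> lists the sums of adjacent entries of row \<open>i\<close>, and
  reversing a word reverses its word of adjacent sums. The last column is left out: the reversed
  segment has columns \<open>i + 1\<close> to \<open>m - 1\<close>.\<close>

lemma symmetric_rows:
  assumes row1: "\<And>j. 2 \<le> j \<Longrightarrow> j < m \<Longrightarrow> a 1 j = a 1 (m + 1 - j)"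
  shows "1 \<le> i \<Longrightarrow> i < j \<Longrightarrow> j < m \<Longrightarrow> a i j = a i (m + i - j)"
proof (induction i arbitrary: j rule: dec_induct)
  case base
  then show ?case using row1[of j] by simp
next
  case (step i)
  have "a (Suc i) j = a i (j - 1) + a i j"
    using rule[of "Suc i" j] step.hyps step.prems by simp
  also have "a i j = a i (m + Suc i - j - 1)"
    using step.IH[of j] step.hyps step.prems by simp
  also have "a i (j - 1) = a i (m + Suc i - j)"
    using step.IH[of "j - 1"] step.hyps step.prems by simp
  also have "a i (m + Suc i - j) + a i (m + Suc i - j - 1) =
      a i (m + Suc i - j - 1) + a i (m + Suc i - j)"
    by (rule add.commute)
  also have "\<dots> = a (Suc i) (m + Suc i - j)"
    using rule[of "Suc i" "m + Suc i - j"] step.hyps step.prems by simp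
  finally show ?case .
qed

text \<open>Parity of the degrees yields the double symmetry; the symmetry of the first row then
  needs exact degrees, since the counts 2 and 0 to be told apart have equal parity.\<close>

lemma regular_odd:
  assumes "even m" "odd d"
    and sym: "\<And>i j. i \<in> {1..m} \<Longrightarrow> j \<in> {1..m} \<Longrightarrow> a i j = a j i"
    and diag: "\<And>i. i \<in> {1..m} \<Longrightarrow> a i i = 0"
    and deg: "\<And>i. i \<in> {1..m} \<Longrightarrow> card {j \<in> {1..m}. a i j = 1} = d"
  shows "\<And>i j. i \<in> {2..<m} \<Longrightarrow> j \<in> {2..<m} \<Longrightarrow> a i j = a (m + 1 - j) (m + 1 - i)"
    and "\<And>i. i \<in> {2..<m} \<Longrightarrow> a 1 i = a 1 (m + 1 - i)"
    and "\<And>i. i \<in> {2..<m} \<Longrightarrow> card {j \<in> {2..<m}. a i j = 1} = d - 1"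
proof -
  have odd_deg: "(\<Sum>k\<in>{1..<i}. a k i) + (\<Sum>j\<in>{i<..m}. a i j) = 1" if i: "1 \<le> i" "i < m" for i
  proof -
    have "(\<Sum>j\<in>{1..m}. a i j) = (\<Sum>j\<in>{j \<in> {1..m}. a i j = 1}. 1)"
      by (rule sum.mono_neutral_cong_right) auto
    also have "\<dots> = of_nat d"
      using deg[of i] i by simp
    also have "\<dots> = 1"
      using \<open>odd d\<close> by (auto elim!: oddE)
    finally have "(\<Sum>j\<in>{1..m}. a i j) = 1" .
    moreover have "{1..m} = insert i ({1..<i} \<union> {i<..m})" "{1..<i} \<inter> {i<..m} = {}"
      using i by auto
    ultimately have "(\<Sum>k\<in>{1..<i}. a i k) + (\<Sum>j\<in>{i<..m}. a i j) = 1"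
      using diag[of i] i by (simp add: sum.union_disjoint)
    moreover have "(\<Sum>k\<in>{1..<i}. a i k) = (\<Sum>k\<in>{1..<i}. a k i)"
      using sym i by (intro sum.cong) auto
    ultimately show ?thesis by simp
  qed
  note inner = odd_imp_doubly_symmetric(1)[OF \<open>even m\<close> odd_deg]
  note outer = odd_imp_doubly_symmetric(2)[OF \<open>even m\<close> odd_deg]
  show refl: "a i j = a (m + 1 - j) (m + 1 - i)" if "i \<in> {2..<m}" "j \<in> {2..<m}" for i j
  proof -
    have mem: "m + 1 - i \<in> {1..m}" "m + 1 - j \<in> {1..m}"
      using that by auto
    show ?thesis
    proof (cases i j rule: linorder_cases)
      case less
      then show ?thesis using inner[of i j] that by simp
    next
      case equal
      then show ?thesis using diag[of i] diag[OF mem(1)] that by simp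
    next
      case greater
      then show ?thesis
        using inner[of j i] sym[of i j] sym[OF mem] that by simp
    qed
  qed
  have deg_split: "of_bool (a 1 i = 1) + of_bool (a i m = 1) + card {j \<in> {2..<m}. a i j = 1} = d"
    if i: "i \<in> {2..<m}" for i
  proof -
    let ?S = "\<lambda>J. {j \<in> J. a i j = 1}"
    have "?S {1..m} = ?S {1} \<union> (?S {m} \<union> ?S {2..<m})"
      using i by auto
    moreover have "?S {1} \<inter> (?S {m} \<union> ?S {2..<m}) = {}" "?S {m} \<inter> ?S {2..<m} = {}"
      using i by auto
    ultimately have "card (?S {1..m}) = card (?S {1}) + (card (?S {m}) + card (?S {2..<m}))"
      by (simp add: card_Un_disjoint)
    moreover have "card (?S {1}) = of_bool (a 1 i = 1)"
      using sym[of 1 i] i by (simp add: Collect_conv_if)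
    moreover have "card (?S {m}) = of_bool (a i m = 1)"
      by (simp add: Collect_conv_if)
    moreover have "card (?S {1..m}) = d"
      using i by (intro deg) auto
    ultimately show ?thesis by linarith
  qed
  have card_refl: "card {j \<in> {2..<m}. a (m + 1 - i) j = 1} = card {j \<in> {2..<m}. a i j = 1}"
    if i: "i \<in> {2..<m}" for i
  proof -
    \<comment> \<open>Both symmetries together give invariance under a half turn, so reversing the
      labels is an automorphism of the inner graph.\<close>
    have eq: "a (m + 1 - i) (m + 1 - j) = a i j" if "j \<in> {2..<m}" for j
      using refl[of j i] sym[of i j] i that by simp
    have "bij_betw (\<lambda>j. m + 1 - j) {j \<in> {2..<m}. a i j = 1} {j \<in> {2..<m}. a (m + 1 - i) j = 1}"
    proof (rule bij_betwI[where g = "\<lambda>j. m + 1 - j"])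
      show "(\<lambda>j. m + 1 - j) \<in> {j \<in> {2..<m}. a (m + 1 - i) j = 1} \<rightarrow> {j \<in> {2..<m}. a i j = 1}"
      proof
        fix j assume j: "j \<in> {j \<in> {2..<m}. a (m + 1 - i) j = 1}"
        then have "m + 1 - j \<in> {2..<m}" by auto
        from this eq[OF this] j show "m + 1 - j \<in> {j \<in> {2..<m}. a i j = 1}"
          by simp
      qed
    qed (use eq in auto)
    then show ?thesis by (simp add: bij_betw_same_card)
  qed
  have mirror: "m + 1 - i \<in> {2..<m}" "a (m + 1 - i) m = a 1 i + 1" "a i m = a 1 (m + 1 - i) + 1"
    if i: "i \<in> {2..<m}" for i
  proof -
    show i': "m + 1 - i \<in> {2..<m}" using i by auto
    show "a (m + 1 - i) m = a 1 i + 1" using outer[of i] i by simp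
    show "a i m = a 1 (m + 1 - i) + 1" using outer[of "m + 1 - i"] i i' by simp
  qed
  \<comment> \<open>If the two entries differed, \<open>mirror\<close> would join one of the
    vertices \<open>i\<close>, \<open>m + 1 - i\<close> to both ends 1 and \<open>m\<close> and the
    other to neither, although their inner degrees agree.\<close>
  show row1: "a 1 i = a 1 (m + 1 - i)" if i: "i \<in> {2..<m}" for i
    using deg_split[OF i] deg_split[OF mirror(1)[OF i]] card_refl[OF i] mirror[OF i]
    by (cases "a 1 i"; cases "a 1 (m + 1 - i)") simp_all
  show "card {j \<in> {2..<m}. a i j = 1} = d - 1" if i: "i \<in> {2..<m}" for i
    using deg_split[OF i] row1[OF i] mirror(3)[OF i] by (cases "a 1 i") auto
qed

end

section \<open>From matrix entries to labelled graphs and vertex deletion\<close>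

lemma out_degree_labelled_graph:
  assumes "labelled_graph G V m"
  shows "out_degree G u = card {j \<in> {1..m}. u \<rightarrow>\<^bsub>G\<^esub> V j}"
proof -
  interpret graph G using assms by (simp add: labelled_graph_def)
  have V: "inj_on V {1..m}" "V ` {1..m} = verts G"
    using assms by (auto simp: labelled_graph_def bij_betw_def)
  \<comment> \<open>The out-degree counts arcs; without multiple arcs it counts neighbours.\<close>
  have "inj_on (head G) (out_arcs G u)"
    by (rule inj_onI) (auto intro: no_multi_arcs simp: arc_to_ends_def)
  moreover have "head G ` out_arcs G u = V ` {j \<in> {1..m}. u \<rightarrow>\<^bsub>G\<^esub> V j}"
  proof
    show "head G ` out_arcs G u \<subseteq> V ` {j \<in> {1..m}. u \<rightarrow>\<^bsub>G\<^esub> V j}"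
    proof
      fix v assume "v \<in> head G ` out_arcs G u"
      then have "u \<rightarrow>\<^bsub>G\<^esub> v" "v \<in> verts G"
        by (auto simp: arcs_ends_conv)
      then show "v \<in> V ` {j \<in> {1..m}. u \<rightarrow>\<^bsub>G\<^esub> V j}"
        unfolding V(2)[symmetric] by auto
    qed
    show "V ` {j \<in> {1..m}. u \<rightarrow>\<^bsub>G\<^esub> V j} \<subseteq> head G ` out_arcs G u"
      by (auto simp: arcs_ends_conv)
  qed
  moreover have "inj_on V {j \<in> {1..m}. u \<rightarrow>\<^bsub>G\<^esub> V j}"
    using V(1) by (rule inj_on_subset) auto
  ultimately show ?thesis
    unfolding out_degree_def by (simp add: card_image flip: card_image[of "head G"])
qed

lemma graph_del_vert:
  assumes "graph G"
  shows "graph (pre_digraph.del_vert G u)"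
proof -
  interpret graph G by (fact assms)
  interpret H: fin_digraph "pre_digraph.del_vert G u"
    by (rule fin_digraph_del_vert)
  show ?thesis
  proof
    show "symmetric (pre_digraph.del_vert G u)"
      using sym_arcs unfolding symmetric_conv by (fastforce simp: del_vert_simps)
  qed (auto simp: del_vert_simps ends_del_vert no_loops no_multi_arcs)
qed

lemma dominates_del_vert:
  "x \<rightarrow>\<^bsub>pre_digraph.del_vert G u\<^esub> y \<longleftrightarrow> x \<rightarrow>\<^bsub>G\<^esub> y \<and> x \<noteq> u \<and> y \<noteq> u"
  by (auto simp: arcs_ends_conv pre_digraph.del_vert_simps)

theorem theorem4:
  fixes G :: "('a, 'b) pre_digraph" and V :: "nat \<Rightarrow> 'a" and n :: nat
  assumes "2 * n \<ge> 4" and "odd n"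
    and "steinhaus_graph G V (2 * n)"
    and "regular_of_degree G n"
  shows "let H = pre_digraph.del_vert (pre_digraph.del_vert G (V 1)) (V (2 * n));
             W = (\<lambda>i. V (i + 1))
         in steinhaus_graph H W (2 * n - 2) \<and>
            regular_of_degree H (n - 1) \<and> even (n - 1) \<and>
            multi_symmetric (adjacency_matrix H W (2 * n - 2))"
proof -
  define m where "m = 2 * n"
  define H where "H = pre_digraph.del_vert (pre_digraph.del_vert G (V 1)) (V m)"
  define W where "W = (\<lambda>i. V (i + 1))"
  define a :: "nat \<Rightarrow> nat \<Rightarrow> bit" where "a i j = (if V i \<rightarrow>\<^bsub>G\<^esub> V j then 1 else 0)" for i j
  let ?M = "adjacency_matrix H W (m - 2)"
  have m: "4 \<le> m" "even m" using assms(1) by (auto simp: m_def)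
  have G: "labelled_graph G V m" and steinhaus_G: "steinhaus_matrix (adjacency_matrix G V m)"
    using assms(3) by (auto simp: steinhaus_graph_def m_def)
  then interpret graph G by (simp add: labelled_graph_def)
  have V: "inj_on V {1..m}" "V ` {1..m} = verts G"
    using G by (auto simp: labelled_graph_def bij_betw_def)
  have entry_G: "entry (adjacency_matrix G V m) i j = a i j" if "i \<in> {1..m}" "j \<in> {1..m}" for i j
    using that by (simp add: entry_adjacency_matrix a_def)
  have dim_G: "dim_row (adjacency_matrix G V m) = m"
    by (simp add: adjacency_matrix_def)
  have sym: "a i j = a j i" for i j
    using arcs_ends_symmetric[OF sym_arcs] by (auto simp: a_def)
  have diag: "a i i = 0" for i
    using adj_not_same by (auto simp: a_def)
  interpret steinhaus m a
  proof
    fix i j :: nat assume ij: "2 \<le> i" "i < j" "j \<le> m"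
    then have "entry (adjacency_matrix G V m) i j =
        entry (adjacency_matrix G V m) (i - 1) (j - 1) + entry (adjacency_matrix G V m) (i - 1) j"
      using steinhaus_G unfolding steinhaus_matrix_def dim_G by blast
    moreover have "i - 1 \<in> {1..m}" "j - 1 \<in> {1..m}"
      using ij by auto
    ultimately show "a i j = a (i - 1) (j - 1) + a (i - 1) j"
      using ij by (simp add: entry_G)
  qed
  have deg: "card {j \<in> {1..m}. a i j = 1} = n" if "i \<in> {1..m}" for i
  proof -
    have "out_degree G (V i) = n"
      using assms(4) V(2) that by (auto simp: regular_of_degree_def)
    moreover have "{j \<in> {1..m}. a i j = 1} = {j \<in> {1..m}. V i \<rightarrow>\<^bsub>G\<^esub> V j}"
      by (auto simp: a_def)
    ultimately show ?thesis
      by (simp only: out_degree_labelled_graph[OF G])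
  qed
  note odd = regular_odd[OF m(2) assms(2) sym diag deg]

  have "graph H"
    unfolding H_def by (intro graph_del_vert) unfold_locales
  have shift: "V ` {2..<m} = W ` {1..m - 2}"
  proof -
    have "{2..<m} = Suc ` {1..m - 2}"
      using m by (auto simp: image_Suc_atLeastAtMost)
    then show ?thesis by (simp only: W_def image_image Suc_eq_plus1)
  qed
  have "{2..<m} = {1..m} - {1, m}" by auto
  then have "V ` {2..<m} = verts G - {V 1, V m}"
    using V m by (simp add: inj_on_image_set_diff[OF V(1)])
  then have "W ` {1..m - 2} = verts H"
    unfolding shift by (auto simp: H_def pre_digraph.del_vert_simps)
  moreover have "inj_on W {1..m - 2}"
    by (rule inj_onI) (auto simp: W_def dest!: inj_onD[OF V(1)])
  ultimately have H: "labelled_graph H W (m - 2)"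
    using \<open>graph H\<close> by (simp add: labelled_graph_def bij_betw_def)

  have V_neq: "V (Suc i) \<noteq> V 1" "V (Suc i) \<noteq> V m" if "i \<in> {1..m - 2}" for i
  proof -
    have "Suc i \<in> {1..m} - {1, m}" "1 \<in> {1..m}" "m \<in> {1..m}"
      using that by auto
    then show "V (Suc i) \<noteq> V 1" "V (Suc i) \<noteq> V m"
      using inj_onD[OF V(1)] by blast+
  qed
  have dom_H: "W i \<rightarrow>\<^bsub>H\<^esub> W j \<longleftrightarrow> a (Suc i) (Suc j) = 1"
    if "i \<in> {1..m - 2}" "j \<in> {1..m - 2}" for i j
    using V_neq[OF that(1)] V_neq[OF that(2)] by (simp add: H_def W_def dominates_del_vert a_def)
  have entry_H: "entry ?M i j = a (Suc i) (Suc j)" if "i \<in> {1..m - 2}" "j \<in> {1..m - 2}" for i j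
    using that by (cases "a (Suc i) (Suc j)") (simp_all add: entry_adjacency_matrix dom_H)
  have M: "square_mat ?M" "dim_row ?M = m - 2"
    by (simp_all add: adjacency_matrix_def)

  have "steinhaus_matrix ?M"
    unfolding steinhaus_matrix_def M(2)
  proof (intro conjI ballI allI impI)
    fix i j assume ij: "2 \<le> i \<and> i < j \<and> j \<le> m - 2"
    then have "Suc j \<le> m" by auto
    then have "a (Suc i) (Suc j) = a (Suc (i - 1)) (Suc (j - 1)) + a (Suc (i - 1)) (Suc j)"
      using rule[of "Suc i" "Suc j"] ij by simp
    moreover have "i \<in> {1..m - 2}" "j \<in> {1..m - 2}" "i - 1 \<in> {1..m - 2}" "j - 1 \<in> {1..m - 2}"
      using ij by auto
    ultimately show "entry ?M i j = entry ?M (i - 1) (j - 1) + entry ?M (i - 1) j"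
      by (simp only: entry_H)
  next
    fix i j assume "i \<in> {1..m - 2}" "j \<in> {1..m - 2}"
    then show "entry ?M i j = entry ?M j i"
      using sym by (simp only: entry_H)
  qed (use m M(1) diag in \<open>simp_all add: entry_H\<close>)
  moreover have "regular_of_degree H (n - 1)"
    unfolding regular_of_degree_def
  proof
    fix v assume "v \<in> verts H"
    then obtain i where i: "i \<in> {1..m - 2}" "v = W i"
      using \<open>W ` {1..m - 2} = verts H\<close> by blast
    have "out_degree H v = card {j \<in> {1..m - 2}. a (Suc i) (Suc j) = 1}"
      unfolding out_degree_labelled_graph[OF H] i(2) using dom_H[OF i(1)]
      by (intro arg_cong[where f = card]) auto
    also have "\<dots> = card (Suc ` {j \<in> {1..m - 2}. a (Suc i) (Suc j) = 1})"
      by (simp add: card_image)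
    also have "Suc ` {j \<in> {1..m - 2}. a (Suc i) (Suc j) = 1} = {j \<in> {2..<m}. a (Suc i) j = 1}"
    proof -
      have "j \<in> Suc ` {j \<in> {1..m - 2}. a (Suc i) (Suc j) = 1}" if "j \<in> {2..<m}" "a (Suc i) j = 1" for j
        using that by (intro image_eqI[of _ _ "j - 1"]) auto
      then show ?thesis by auto
    qed
    also have "card \<dots> = n - 1"
      using i by (intro odd(3)) auto
    finally show "out_degree H v = n - 1" .
  qed
  moreover have "doubly_symmetric ?M"
    unfolding doubly_symmetric_def M(2)
  proof (intro conjI ballI)
    fix i j assume ij: "i \<in> {1..m - 2}" "j \<in> {1..m - 2}"
    then show "entry ?M i j = entry ?M j i"
      using sym by (simp add: entry_H)
    \<comment> \<open>Inner label \<open>i\<close> is outer label \<open>i + 1\<close>, and this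
      shift commutes with the label reversals of sizes \<open>m - 2\<close> and
      \<open>m\<close>.\<close>
    have "m - 2 - j + 1 \<in> {1..m - 2}" "m - 2 - i + 1 \<in> {1..m - 2}"
      "Suc (m - 2 - j + 1) = m + 1 - Suc j" "Suc (m - 2 - i + 1) = m + 1 - Suc i"
      using ij m by auto
    then show "entry ?M j i = entry ?M (m - 2 - j + 1) (m - 2 - i + 1)"
      using ij odd(1)[of "Suc i" "Suc j"] sym[of "Suc j" "Suc i"] by (simp add: entry_H)
  qed (fact M(1))
  moreover have "entry ?M i j = entry ?M i (m - 2 - j + i + 1)"
    if ij: "1 \<le> i" "i < j" "j \<le> m - 2" for i j
  proof -
    have "m - 2 - j + i + 1 \<in> {1..m - 2}" "Suc (m - 2 - j + i + 1) = m + Suc i - Suc j"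
      using ij by auto
    then show ?thesis
      using symmetric_rows[OF odd(2), of "Suc i" "Suc j"] ij by (simp add: entry_H)
  qed
  ultimately have "steinhaus_graph H W (m - 2) \<and> regular_of_degree H (n - 1) \<and>
      multi_symmetric ?M"
    unfolding steinhaus_graph_def multi_symmetric_def M(2) using H by blast
  then show ?thesis
    using assms(2) by (simp add: H_def W_def m_def)
qed

end
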